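(* For every integer $n \ge 0$ let $$r(n,t) = \sum_{j=0}^{n} (-t)^{n-j} \binom{n}{j}\binom{n+j}{j} H_j(t).$$ Then, as an identity of polynomials in $t$, for all $n\ge 0$ $$\det\left(H_{i+j}(t)\right)_{i,j=0}^{n} = (-1)^n\, \frac{t^{n^2}\, r(n,t)}{\binom{2n}{n}\prod_{j=1}^{n-1}(2j+1)\binom{2j}{j}^2}.$$
   Context: For integers $m \ge 0$, $H_m(t) = \sum_{k=1}^{m} \frac{t^k}{k}$, a polynomial in $t$ with rational coefficients (so $H_0(t)=0$). The notation $(a_{i,j})_{i,j=0}^{n}$ denotes the $(n+1)\times(n+1)$ matrix with indices $0\le i,j\le n$. Empty products equal $1$. *)

theory Defs
  imports "Jordan_Normal_Form.Determinant"
begin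

definition H :: "nat \<Rightarrow> rat poly" where
  "H m = (\<Sum>k=1..m. monom (1 / of_nat k) k)"

definition r :: "nat \<Rightarrow> rat poly" where
  "r n = (\<Sum>j=0..n. (- monom 1 1) ^ (n - j) * of_nat (n choose j) * of_nat ((n + j) choose j) * H j)"

end

theory Submission
  imports Defs
begin

text \<open>
  Put \<open>L(x^m) = H m\<close>, that is \<open>L(p) = \<integral>\<^sub>0\<^sup>t (p(x) - p(1)) / (x - 1) dx\<close>, so that
  \<open>L((x - 1) p) = \<integral>\<^sub>0\<^sup>t p(x) dx\<close>. Let \<open>P\<^sub>i\<close> be the Legendre polynomials
  of the interval \<open>[0, t]\<close>, normalised such that \<open>L(P\<^sub>n) = r n\<close>. Changing the basis to
  \<open>P\<^sub>0, \<dots>, P\<^sub>n\<close> in the rows and to \<open>1, (x - 1) P\<^sub>0, \<dots>, (x - 1) P\<^sub>n\<^sub>-\<^sub>1\<close> in the columns turns the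
  Hankel matrix into one whose column 0 is \<open>r 0, \<dots>, r n\<close> and whose other columns are, by
  orthogonality, diagonal with entries \<open>\<integral>\<^sub>0\<^sup>t P\<^sub>i\<^sup>2 = t^(2i+1) / (2i+1)\<close>.
\<close>

section \<open>Alternating binomial sums as iterated differences\<close>

definition alt_binomial_sum :: "nat \<Rightarrow> (nat \<Rightarrow> rat) \<Rightarrow> rat" where
  "alt_binomial_sum m f = (\<Sum>k\<le>m. (-1) ^ k * of_nat (m choose k) * f k)"

lemma alt_binomial_sum_0 [simp]: "alt_binomial_sum 0 f = f 0"
  by (simp add: alt_binomial_sum_def)

text \<open>Pascal's rule. Hence \<open>alt_binomial_sum m\<close> applies the difference operator
  f(k) - f(k + 1) exactly \<open>m\<close> times and evaluates at 0, which drives the inductions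
  below.\<close>

lemma alt_binomial_sum_Suc:
  "alt_binomial_sum (Suc m) f = alt_binomial_sum m (\<lambda>k. f k - f (Suc k))"
proof -
  \<comment> \<open>Since \<open>m choose Suc m = 0\<close>, the sum for \<open>m\<close> may run to
    \<open>Suc m\<close>; splitting off \<open>k = 0\<close> and reindexing gives the shifted
    sum.\<close>
  have *: "(\<Sum>k\<le>m. (-1) ^ k * of_nat (m choose Suc k) * f (Suc k)) =
    f 0 - (\<Sum>k\<le>m. (-1) ^ k * of_nat (m choose k) * f k)"
  proof -
    have "(\<Sum>k\<le>m. (-1) ^ k * of_nat (m choose k) * f k) =
      (\<Sum>k\<le>Suc m. (-1) ^ k * of_nat (m choose k) * f k)"
      by simp
    also have "\<dots> = f 0 - (\<Sum>k\<le>m. (-1) ^ k * of_nat (m choose Suc k) * f (Suc k))"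
      by (subst sum.atMost_Suc_shift) (simp add: sum_negf)
    finally show ?thesis by simp
  qed
  have "alt_binomial_sum (Suc m) f =
    f 0 - (\<Sum>k\<le>m. (-1) ^ k * of_nat (Suc m choose Suc k) * f (Suc k))"
    unfolding alt_binomial_sum_def by (subst sum.atMost_Suc_shift) (simp add: sum_negf)
  also have "\<dots> = f 0 - (\<Sum>k\<le>m. (-1) ^ k * of_nat (m choose Suc k) * f (Suc k))
      - (\<Sum>k\<le>m. (-1) ^ k * of_nat (m choose k) * f (Suc k))"
    by (simp add: algebra_simps sum.distrib)
  also have "\<dots> = alt_binomial_sum m (\<lambda>k. f k - f (Suc k))"
    unfolding * alt_binomial_sum_def by (simp add: algebra_simps sum_subtractf)
  finally show ?thesis .
qed

lemma alt_binomial_sum_cong: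
  "(\<And>k. f k = g k) \<Longrightarrow> alt_binomial_sum m f = alt_binomial_sum m g"
  by (simp add: alt_binomial_sum_def)

lemma alt_binomial_sum_add:
  "alt_binomial_sum m (\<lambda>k. f k + g k) = alt_binomial_sum m f + alt_binomial_sum m g"
  by (simp add: alt_binomial_sum_def algebra_simps sum.distrib)

lemma alt_binomial_sum_mult:
  "alt_binomial_sum m (\<lambda>k. c * f k) = c * alt_binomial_sum m f"
  by (simp add: alt_binomial_sum_def sum_distrib_left algebra_simps)

lemma pochhammer_shift_diff:
  "pochhammer (x :: rat) (Suc a) - pochhammer (x + 1) (Suc a) =
    - of_nat (Suc a) * pochhammer (x + 1) a"
  unfolding pochhammer_rec[of x a] pochhammer_Suc[of "x + 1" a] by (simp add: algebra_simps)

text \<open>In \<open>k\<close> this is a polynomial of degree \<open>a\<close>, and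
  \<open>m > a\<close> differences annihilate it. Each difference lowers \<open>a\<close> and shifts
  \<open>x\<close> by one, so \<open>x\<close> is generalised in the induction.\<close>

lemma alt_binomial_sum_pochhammer:
  "a < m \<Longrightarrow> alt_binomial_sum m (\<lambda>k. pochhammer (of_nat k + x) a) = 0"
proof (induction m arbitrary: a x)
  case (Suc m)
  show ?case
  proof (cases a)
    case 0
    then show ?thesis by (simp add: alt_binomial_sum_Suc) (simp add: alt_binomial_sum_def)
  next
    case (Suc b)
    have "alt_binomial_sum (Suc m) (\<lambda>k. pochhammer (of_nat k + x) a) =
      alt_binomial_sum m (\<lambda>k. - of_nat (Suc b) * pochhammer (of_nat k + (x + 1)) b)"
      unfolding alt_binomial_sum_Suc Suc
      using pochhammer_shift_diff[of "of_nat _ + x" b]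
      by (intro alt_binomial_sum_cong) (simp add: add_ac)
    also have "\<dots> = 0"
      unfolding alt_binomial_sum_mult using Suc.IH[of b "x + 1"] Suc.prems Suc by simp
    finally show ?thesis .
  qed
qed simp

text \<open>The partial fraction expansion of m! / (x (x + 1) ... (x + m)).\<close>

lemma alt_binomial_sum_inverse:
  "x > 0 \<Longrightarrow> alt_binomial_sum m (\<lambda>k. 1 / (of_nat k + x)) = fact m / pochhammer x (Suc m)"
proof (induction m arbitrary: x)
  case (Suc m)
  have [simp]: "pochhammer x (Suc m) > 0" "pochhammer (x + 1) (Suc m) > 0" "pochhammer (x + 1) m > 0"
    using Suc.prems by (auto intro!: pochhammer_pos)
  have "alt_binomial_sum (Suc m) (\<lambda>k. 1 / (of_nat k + x)) =
    alt_binomial_sum m (\<lambda>k. 1 / (of_nat k + x) + (-1) * (1 / (of_nat k + (x + 1))))"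
    unfolding alt_binomial_sum_Suc by (rule alt_binomial_sum_cong) (simp add: add_ac)
  also have "\<dots> = fact m / pochhammer x (Suc m) - fact m / pochhammer (x + 1) (Suc m)"
    unfolding alt_binomial_sum_add alt_binomial_sum_mult using Suc.IH Suc.prems by simp
  also have "\<dots> = fact (Suc m) / pochhammer x (Suc (Suc m))"
  proof -
    define q where "q = pochhammer (x + 1) m"
    have q: "q > 0" by (simp add: q_def)
    have p: "pochhammer x (Suc m) = x * q" "pochhammer (x + 1) (Suc m) = q * (x + 1 + of_nat m)"
      "pochhammer x (Suc (Suc m)) = x * (q * (x + 1 + of_nat m))"
      unfolding q_def pochhammer_rec[of x] pochhammer_Suc[of "x + 1"] by simp_all
    have "x + 1 + of_nat m > 0" using Suc.prems by (simp add: add_pos_nonneg)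
    then show ?thesis unfolding p using q Suc.prems
      by (simp add: divide_simps) (simp add: algebra_simps)
  qed
  finally show ?case .
qed simp

text \<open>Split the new factor k + 1 + a as (k + x) + (1 - x + a). The first summand cancels the
  denominator and leaves a polynomial of degree a < m, whose sum vanishes; the second contributes
  the next factor of \<open>pochhammer (1 - x)\<close>.\<close>

lemma alt_binomial_sum_pochhammer_divide:
  assumes "a \<le> m" "x > 0"
  shows "alt_binomial_sum m (\<lambda>k. pochhammer (of_nat k + 1) a / (of_nat k + x)) =
    pochhammer (1 - x) a * fact m / pochhammer x (Suc m)"
  using assms(1)
proof (induction a)
  case 0
  then show ?case using alt_binomial_sum_inverse[OF assms(2)] by simp
next
  case (Suc a)
  have *: "pochhammer (of_nat k + 1) (Suc a) / (of_nat k + x) =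
    pochhammer (of_nat k + 1) a + (1 - x + of_nat a) * (pochhammer (of_nat k + 1) a / (of_nat k + x))" for k
  proof -
    have "of_nat k + x > 0" using assms by (simp add: add_nonneg_pos)
    then show ?thesis by (simp add: pochhammer_Suc divide_simps) (simp add: algebra_simps)
  qed
  show ?case
    unfolding * alt_binomial_sum_add alt_binomial_sum_mult
    using Suc alt_binomial_sum_pochhammer[of a m 1] by (simp add: pochhammer_Suc)
qed

section \<open>Legendre polynomials: moments and orthogonality, first on [0, 1], then on
  [0, t]\<close>

definition legendre_coeff :: "nat \<Rightarrow> nat \<Rightarrow> rat" where
  "legendre_coeff i k = (-1) ^ (i + k) * of_nat (i choose k) * of_nat ((i + k) choose k)"

lemma legendre_coeff_eq_0: "i < k \<Longrightarrow> legendre_coeff i k = 0"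
  by (simp add: legendre_coeff_def)

lemma legendre_coeff_diag: "legendre_coeff i i = of_nat ((2 * i) choose i)"
  by (simp add: legendre_coeff_def mult_2)

lemma legendre_coeff_pochhammer:
  "legendre_coeff i k =
    (-1) ^ i * ((-1) ^ k * of_nat (i choose k) * pochhammer (of_nat k + 1) i) / fact i"
proof -
  have "of_nat ((i + k) choose k) = (pochhammer (of_nat k + 1) i / fact i :: rat)"
    using binomial_symmetric[of k "i + k"]
    by (simp add: binomial_gbinomial gbinomial_pochhammer' add_ac)
  then show ?thesis by (simp add: legendre_coeff_def power_add)
qed

text \<open>The left side is the integral over [0, 1] of x^l times the \<open>i\<close>-th shifted
  Legendre polynomial; the preceding sum is used with x = l + 1, so that 1 - x = -l.\<close>

lemma sum_legendre_coeff_divide: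
  "(\<Sum>k\<le>i. legendre_coeff i k / of_nat (k + l + 1)) =
    (-1) ^ i * pochhammer (- of_nat l) i / pochhammer (of_nat l + 1) (Suc i)"
proof -
  have "(\<Sum>k\<le>i. legendre_coeff i k / of_nat (k + l + 1)) =
    (-1) ^ i / fact i *
      alt_binomial_sum i (\<lambda>k. pochhammer (of_nat k + 1) i / (of_nat k + (of_nat l + 1)))"
    unfolding alt_binomial_sum_def sum_distrib_left
    by (intro sum.cong refl) (simp add: legendre_coeff_pochhammer add_ac)
  then show ?thesis by (simp add: alt_binomial_sum_pochhammer_divide)
qed

text \<open>For \<open>l < i\<close> the product \<open>pochhammer (- of_nat l) i\<close> contains
  the factor 0.\<close>

lemma sum_legendre_coeff_divide_eq_0:
  "l < i \<Longrightarrow> (\<Sum>k\<le>i. legendre_coeff i k / of_nat (k + l + 1)) = 0"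
  unfolding sum_legendre_coeff_divide by (simp add: pochhammer_of_nat_eq_0_lemma)

lemma sum_legendre_coeff_divide_diag:
  "(\<Sum>k\<le>i. legendre_coeff i k / of_nat (k + i + 1)) =
    1 / (of_nat (2 * i + 1) * of_nat ((2 * i) choose i))"
proof -
  \<comment> \<open>The product 1 * 2 * ... * (2i + 1) is cut after its first \<open>i\<close>
    factors.\<close>
  have "fact (2 * i + 1) = (fact i * pochhammer (of_nat i + 1) (Suc i) :: rat)"
    using pochhammer_product'[of "1 :: rat" i "Suc i"]
    by (simp add: pochhammer_fact mult_2 add_ac)
  then have p: "pochhammer (of_nat i + 1) (Suc i) = (fact (2 * i + 1) / fact i :: rat)"
    by simp
  have c: "of_nat ((2 * i) choose i) = (fact (2 * i) / (fact i * fact i) :: rat)"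
    by (simp add: binomial_fact)
  have s: "(-1) ^ i * pochhammer (- of_nat i) i = (fact i :: rat)"
    by (simp add: pochhammer_same flip: power_mult_distrib)
  show ?thesis
    unfolding sum_legendre_coeff_divide s p c by (simp add: field_simps)
qed

text \<open>For \<open>j \<le> i\<close>, expand the \<open>j\<close>-th polynomial into monomials:
  all moments below \<open>i\<close> vanish, so only \<open>l = i\<close> can survive, where the
  leading coefficient cancels the binomial in the moment. The other case follows by
  symmetry.\<close>

lemma legendre_orthogonal:
  "(\<Sum>k\<le>i. \<Sum>l\<le>j. legendre_coeff i k * legendre_coeff j l / of_nat (k + l + 1)) =
    (if i = j then 1 / of_nat (2 * i + 1) else 0)"
proof -
  have less: "(\<Sum>k\<le>i. \<Sum>l\<le>j. legendre_coeff i k * legendre_coeff j l / of_nat (k + l + 1)) =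
    (if i = j then 1 / of_nat (2 * i + 1) else 0)" if "j \<le> i" for i j
  proof -
    have "(\<Sum>k\<le>i. \<Sum>l\<le>j. legendre_coeff i k * legendre_coeff j l / of_nat (k + l + 1)) =
      (\<Sum>l\<le>j. legendre_coeff j l * (\<Sum>k\<le>i. legendre_coeff i k / of_nat (k + l + 1)))"
      by (subst sum.swap) (simp add: sum_distrib_left mult_ac)
    also have "\<dots> = (\<Sum>l\<le>j. if l = i then
        legendre_coeff j l * (1 / (of_nat (2 * i + 1) * of_nat ((2 * i) choose i))) else 0)"
      using that sum_legendre_coeff_divide_eq_0 sum_legendre_coeff_divide_diag
      by (intro sum.cong refl) auto
    also have "\<dots> = (if i = j then 1 / of_nat (2 * i + 1) else 0)"
      using that by (auto simp: legendre_coeff_diag)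
    finally show ?thesis .
  qed
  show ?thesis
  proof (cases "j \<le> i")
    case False
    have "(\<Sum>k\<le>i. \<Sum>l\<le>j. legendre_coeff i k * legendre_coeff j l / of_nat (k + l + 1)) =
      (\<Sum>l\<le>j. \<Sum>k\<le>i. legendre_coeff j l * legendre_coeff i k / of_nat (l + k + 1))"
      by (subst sum.swap) (simp add: mult_ac add_ac)
    then show ?thesis using less[of i j] False by simp
  qed (fact less)
qed

text \<open>The coefficient of x^k in t^i p(x/t), where p is the \<open>i\<close>-th shifted
  Legendre polynomial of [0, 1]. For \<open>k > i\<close> the truncated exponent is harmless because
  the coefficient is 0.\<close>

definition legendre :: "nat \<Rightarrow> nat \<Rightarrow> rat poly" where
  "legendre i k = monom (legendre_coeff i k) (i - k)"

lemma legendre_eq_0: "i < k \<Longrightarrow> legendre i k = 0"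
  by (simp add: legendre_def legendre_coeff_eq_0)

lemma H_Suc: "H (Suc m) = H m + monom (1 / of_nat (Suc m)) (Suc m)"
  by (simp add: H_def)

lemma r_legendre: "r n = (\<Sum>k\<le>n. legendre n k * H k)"
proof -
  have "(- monom 1 1) ^ (n - k) * of_nat (n choose k) * of_nat ((n + k) choose k) = legendre n k"
    if "k \<le> n" for k
  proof -
    have "(- monom 1 1 :: rat poly) ^ (n - k) = monom ((-1) ^ (n - k)) (n - k)"
      by (simp add: monom_power minus_monom)
    moreover have "(-1 :: rat) ^ (n - k) = (-1) ^ (n + k)"
      using that by (simp add: minus_one_power_iff)
    ultimately show ?thesis
      by (simp add: legendre_def legendre_coeff_def of_nat_poly smult_monom mult_ac)
  qed
  then show ?thesis
    unfolding r_def by (intro sum.cong) auto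
qed

text \<open>The difference of consecutive \<open>H\<close> is t^(k+l+1) / (k+l+1), so every summand
  has the same degree (i - k) + (j - l) + (k + l + 1) = i + j + 1 in t, and orthogonality on [0, 1]
  applies to the coefficients.\<close>

lemma legendre_orthogonal_poly:
  "(\<Sum>k\<le>i. \<Sum>l\<le>j. legendre i k * legendre j l * (H (Suc (k + l)) - H (k + l))) =
    (if i = j then monom (1 / of_nat (2 * i + 1)) (2 * i + 1) else 0)"
proof -
  have "(\<Sum>k\<le>i. \<Sum>l\<le>j. legendre i k * legendre j l * (H (Suc (k + l)) - H (k + l))) =
    (\<Sum>k\<le>i. \<Sum>l\<le>j.
      monom (legendre_coeff i k * legendre_coeff j l / of_nat (k + l + 1)) (i + j + 1))"
    by (intro sum.cong refl) (simp add: H_Suc legendre_def mult_monom)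
  also have "\<dots> = monom (\<Sum>k\<le>i. \<Sum>l\<le>j.
      legendre_coeff i k * legendre_coeff j l / of_nat (k + l + 1)) (i + j + 1)"
    by (simp add: monom_sum)
  also have "\<dots> = (if i = j then monom (1 / of_nat (2 * i + 1)) (2 * i + 1) else 0)"
    unfolding legendre_orthogonal by (cases "i = j") (simp_all flip: mult_2)
  finally show ?thesis .
qed

section \<open>Change of basis in the Hankel matrix and its determinants\<close>

definition hankel_mat :: "nat \<Rightarrow> rat poly mat" where
  "hankel_mat n = mat (n + 1) (n + 1) (\<lambda>(i, j). H (i + j))"

definition legendre_mat :: "nat \<Rightarrow> rat poly mat" where
  "legendre_mat n = mat (n + 1) (n + 1) (\<lambda>(i, k). legendre i k)"

text \<open>Column \<open>j + 1\<close> holds the coefficients of \<open>(x - 1) P\<^sub>j\<close>.\<close>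

definition shifted_mat :: "nat \<Rightarrow> rat poly mat" where
  "shifted_mat n = mat (n + 1) (n + 1) (\<lambda>(l, j). case j of
     0 \<Rightarrow> (if l = 0 then 1 else 0)
   | Suc j' \<Rightarrow> (case l of 0 \<Rightarrow> 0 | Suc l' \<Rightarrow> legendre j' l') - legendre j' l)"

definition reduced_mat :: "nat \<Rightarrow> rat poly mat" where
  "reduced_mat n = mat (n + 1) (n + 1) (\<lambda>(i, j). case j of
     0 \<Rightarrow> r i
   | Suc j' \<Rightarrow> (if i = j' then monom (1 / of_nat (2 * i + 1)) (2 * i + 1) else 0))"

lemma mat_carrier_Suc [simp]:
  "hankel_mat n \<in> carrier_mat (Suc n) (Suc n)" "legendre_mat n \<in> carrier_mat (Suc n) (Suc n)"
  "shifted_mat n \<in> carrier_mat (Suc n) (Suc n)" "reduced_mat n \<in> carrier_mat (Suc n) (Suc n)"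
  by (simp_all add: hankel_mat_def legendre_mat_def shifted_mat_def reduced_mat_def)

lemma det_legendre_mat:
  "det (legendre_mat n) = [:\<Prod>i\<le>n. of_nat ((2 * i) choose i):]"
proof -
  have "det (legendre_mat n) = prod_list (diag_mat (legendre_mat n))"
    by (rule det_lower_triangular[of "Suc n"])
      (auto simp: legendre_mat_def legendre_eq_0)
  also have "\<dots> = (\<Prod>i<Suc n. legendre_mat n $$ (i, i))"
    unfolding prod_list_diag_prod by (simp add: legendre_mat_def atLeast0LessThan)
  also have "\<dots> = (\<Prod>i<Suc n. [:of_nat ((2 * i) choose i):])"
    by (intro prod.cong refl)
      (simp add: legendre_mat_def legendre_def legendre_coeff_diag monom_0)
  also have "\<dots> = [:\<Prod>i<Suc n. of_nat ((2 * i) choose i):]"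
    by (induction n) (simp_all add: mult_ac)
  finally show ?thesis by (simp only: lessThan_Suc_atMost)
qed

text \<open>Column \<open>Suc j\<close> belongs to a polynomial of degree j + 1 in x, so the matrix
  is upper triangular, with the leading coefficient of the \<open>j\<close>-th Legendre polynomial
  on the diagonal.\<close>

lemma det_shifted_mat:
  "det (shifted_mat n) = [:\<Prod>j<n. of_nat ((2 * j) choose j):]"
proof -
  have "det (shifted_mat n) = prod_list (diag_mat (shifted_mat n))"
    by (rule det_upper_triangular[of _ "Suc n"])
      (auto simp: shifted_mat_def upper_triangular_def legendre_eq_0 split: nat.splits)
  also have "\<dots> = (\<Prod>j<Suc n. shifted_mat n $$ (j, j))"
    unfolding prod_list_diag_prod by (simp add: shifted_mat_def atLeast0LessThan)
  also have "\<dots> = (\<Prod>j<n. shifted_mat n $$ (Suc j, Suc j))"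
    unfolding prod.lessThan_Suc_shift by (simp add: shifted_mat_def)
  also have "\<dots> = (\<Prod>j<n. [:of_nat ((2 * j) choose j):])"
    by (intro prod.cong refl)
      (simp add: shifted_mat_def legendre_def legendre_coeff_diag legendre_coeff_eq_0 monom_0)
  also have "\<dots> = [:\<Prod>j<n. of_nat ((2 * j) choose j):]"
    by (induction n) (simp_all add: mult_ac)
  finally show ?thesis .
qed

text \<open>The entry is L applied to x^k times the polynomial of column \<open>j\<close>.\<close>

lemma hankel_mat_mult_shifted_mat:
  assumes "k \<le> n" "j \<le> n"
  shows "(hankel_mat n * shifted_mat n) $$ (k, j) = (case j of 0 \<Rightarrow> H k
    | Suc j' \<Rightarrow> \<Sum>l\<le>j'. legendre j' l * (H (Suc (k + l)) - H (k + l)))"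
proof -
  have *: "(hankel_mat n * shifted_mat n) $$ (k, j) =
    (\<Sum>l\<le>n. H (k + l) * shifted_mat n $$ (l, j))"
    using assms by (simp add: hankel_mat_def shifted_mat_def scalar_prod_def
        atLeast0LessThan lessThan_Suc_atMost)
  show ?thesis
  proof (cases j)
    case 0
    have "(\<Sum>l\<le>n. H (k + l) * shifted_mat n $$ (l, j)) = (\<Sum>l\<le>n. if l = 0 then H k else 0)"
      by (intro sum.cong refl) (auto simp: 0 shifted_mat_def)
    then show ?thesis using 0 * by simp
  next
    case (Suc j')
    then have j': "j' < n" using assms by simp
    have "(\<Sum>l\<le>n. H (k + l) * shifted_mat n $$ (l, j)) =
      (\<Sum>l\<le>n. H (k + l) * (case l of 0 \<Rightarrow> 0 | Suc l' \<Rightarrow> legendre j' l')) -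
      (\<Sum>l\<le>n. H (k + l) * legendre j' l)"
      unfolding sum_subtractf[symmetric]
      by (intro sum.cong refl) (use assms in \<open>auto simp: Suc shifted_mat_def algebra_simps\<close>)
    also have "(\<Sum>l\<le>n. H (k + l) * (case l of 0 \<Rightarrow> 0 | Suc l' \<Rightarrow> legendre j' l')) =
      (\<Sum>l<n. H (Suc (k + l)) * legendre j' l)"
      unfolding lessThan_Suc_atMost[symmetric] sum.lessThan_Suc_shift by simp
    \<comment> \<open>As \<open>j' < n\<close>, the range \<open>l < n\<close> still contains every
      nonzero coefficient.\<close>
    also have "\<dots> = (\<Sum>l\<le>j'. H (Suc (k + l)) * legendre j' l)"
      using j' by (intro sum.mono_neutral_right) (auto simp: legendre_eq_0)
    also have "(\<Sum>l\<le>n. H (k + l) * legendre j' l) = (\<Sum>l\<le>j'. H (k + l) * legendre j' l)"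
      using j' by (intro sum.mono_neutral_right) (auto simp: legendre_eq_0)
    finally show ?thesis
      unfolding * by (simp add: Suc algebra_simps sum_subtractf)
  qed
qed

lemma reduced_mat_eq: "legendre_mat n * (hankel_mat n * shifted_mat n) = reduced_mat n"
proof (rule eq_matI)
  fix i j assume "i < dim_row (reduced_mat n)" "j < dim_col (reduced_mat n)"
  then have ij: "i \<le> n" "j \<le> n" by (simp_all add: reduced_mat_def)
  have "(legendre_mat n * (hankel_mat n * shifted_mat n)) $$ (i, j) =
    (\<Sum>k\<le>n. legendre i k * (hankel_mat n * shifted_mat n) $$ (k, j))"
    using ij by (simp add: legendre_mat_def hankel_mat_def shifted_mat_def scalar_prod_def
        atLeast0LessThan lessThan_Suc_atMost)
  also have "\<dots> = (\<Sum>k\<le>i. legendre i k * (hankel_mat n * shifted_mat n) $$ (k, j))"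
    using ij by (intro sum.mono_neutral_right) (auto simp: legendre_eq_0)
  also have "\<dots> = (\<Sum>k\<le>i. legendre i k * (case j of 0 \<Rightarrow> H k
    | Suc j' \<Rightarrow> \<Sum>l\<le>j'. legendre j' l * (H (Suc (k + l)) - H (k + l))))"
    using ij by (intro sum.cong refl) (simp add: hankel_mat_mult_shifted_mat)
  also have "\<dots> = reduced_mat n $$ (i, j)"
    using ij legendre_orthogonal_poly[of i "j - 1"]
    by (cases j) (simp_all add: reduced_mat_def r_legendre sum_distrib_left mult_ac)
  finally show "(legendre_mat n * (hankel_mat n * shifted_mat n)) $$ (i, j) =
    reduced_mat n $$ (i, j)" .
qed (simp_all add: legendre_mat_def shifted_mat_def reduced_mat_def)

text \<open>Column \<open>Suc j'\<close> is nonzero only in row \<open>j' < n\<close>, so row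
  \<open>n\<close> has only its entry \<open>r n\<close> in column 0. Deleting that row and column
  leaves a diagonal matrix, and the exponents 1 + 3 + ... + (2n - 1) add up to n^2.\<close>

lemma det_reduced_mat:
  "det (reduced_mat n) =
    smult ((-1) ^ n / (\<Prod>j<n. of_nat (2 * j + 1))) (monom 1 (n ^ 2) * r n)"
proof -
  define D where "D = mat_delete (reduced_mat n) n 0"
  have D: "D = mat n n (\<lambda>(i, j). if i = j then monom (1 / of_nat (2 * i + 1)) (2 * i + 1) else 0)"
    unfolding D_def by (rule eq_matI) (auto simp: mat_delete_def reduced_mat_def)
  have "det D = prod_list (diag_mat D)"
    by (rule det_upper_triangular[of _ n]) (auto simp: D upper_triangular_def)
  also have "\<dots> = (\<Prod>i<n. monom (1 / of_nat (2 * i + 1)) (2 * i + 1))"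
    unfolding prod_list_diag_prod by (simp add: D atLeast0LessThan)
  also have "\<dots> = monom (1 / (\<Prod>j<n. of_nat (2 * j + 1))) (n ^ 2)"
  proof (induction n)
    case (Suc n)
    have "(Suc n)\<^sup>2 = n\<^sup>2 + (2 * n + 1)" by (simp add: power2_eq_square)
    then show ?case by (simp only: prod.lessThan_Suc Suc.IH mult_monom) simp
  qed simp
  finally have det_D: "det D = monom (1 / (\<Prod>j<n. of_nat (2 * j + 1))) (n ^ 2)" .
  have "det (reduced_mat n) =
    (\<Sum>j<Suc n. reduced_mat n $$ (n, j) * cofactor (reduced_mat n) n j)"
    by (rule laplace_expansion_row) simp_all
  also have "\<dots> = reduced_mat n $$ (n, 0) * cofactor (reduced_mat n) n 0"
    unfolding sum.lessThan_Suc_shift by (simp add: reduced_mat_def)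
  also have "\<dots> = r n * ((-1) ^ n * det D)"
    by (simp add: cofactor_def D_def) (simp add: reduced_mat_def)
  also have "(-1) ^ n * det D = smult ((-1) ^ n) (det D)"
    by (cases "even n") simp_all
  also have "det D = smult (1 / (\<Prod>j<n. of_nat (2 * j + 1))) (monom 1 (n ^ 2))"
    by (simp add: det_D smult_monom)
  finally show ?thesis by (simp add: mult.commute)
qed

theorem theorem3p1:
  fixes n :: nat
  shows "det (mat (n + 1) (n + 1) (\<lambda>(i, j). H (i + j))) =
    smult ((-1) ^ n /
        (of_nat ((2 * n) choose n) *
          (\<Prod>j=1..<n. of_nat (2 * j + 1) * of_nat ((2 * j) choose j) ^ 2)))
      (monom 1 (n ^ 2) * r n)"
proof -
  define c :: rat where "c = (\<Prod>j<n. of_nat ((2 * j) choose j))"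
  define d :: rat where "d = (\<Prod>j<n. of_nat (2 * j + 1))"
  define b :: rat where "b = of_nat ((2 * n) choose n)"
  have nz: "c \<noteq> 0" "b \<noteq> 0" by (simp_all add: c_def b_def)
  have "det (reduced_mat n) = det (legendre_mat n) * (det (hankel_mat n) * det (shifted_mat n))"
    unfolding reduced_mat_eq[symmetric]
    by (simp add: det_mult[of _ "Suc n"] mult_carrier_mat[of _ "Suc n" "Suc n"])
  \<comment> \<open>The row change has one more diagonal entry from the binomials than the column
    change; this is \<open>b\<close>, and the rest is \<open>c\<close> twice.\<close>
  also have "\<dots> = smult (b * c ^ 2) (det (hankel_mat n))"
    unfolding det_legendre_mat det_shifted_mat
    by (simp add: b_def c_def power2_eq_square mult_ac flip: lessThan_Suc_atMost)
  finally have "smult (b * c ^ 2) (det (hankel_mat n)) =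
    smult ((-1) ^ n / d) (monom 1 (n ^ 2) * r n)"
    by (simp add: det_reduced_mat d_def)
  then have "smult (1 / (b * c ^ 2)) (smult (b * c ^ 2) (det (hankel_mat n))) =
    smult (1 / (b * c ^ 2)) (smult ((-1) ^ n / d) (monom 1 (n ^ 2) * r n))"
    by simp
  then have "det (hankel_mat n) = smult ((-1) ^ n / (b * (d * c ^ 2))) (monom 1 (n ^ 2) * r n)"
    using nz by (simp add: mult_ac)
  moreover have "d * c ^ 2 = (\<Prod>j=1..<n. of_nat (2 * j + 1) * of_nat ((2 * j) choose j) ^ 2)"
  proof -
    have "d * c ^ 2 = (\<Prod>j\<in>{0..<n}. of_nat (2 * j + 1) * of_nat ((2 * j) choose j) ^ 2)"
      by (simp add: d_def c_def prod.distrib prod_power_distrib atLeast0LessThan)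
    \<comment> \<open>The factor at \<open>j = 0\<close> equals 1.\<close>
    also have "\<dots> = (\<Prod>j=1..<n. of_nat (2 * j + 1) * of_nat ((2 * j) choose j) ^ 2)"
      by (rule prod.mono_neutral_right) (auto simp: not_le)
    finally show ?thesis .
  qed
  ultimately show ?thesis by (simp add: hankel_mat_def b_def)
qed

end
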